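(* There is an algorithm which, given $\epsilon>0$, $u>0$, $\rho'>0$ and a vector $f\in\mathbb{R}^k$ with $\|f\|_1\le\rho' u$, computes a $k\times k$ matrix $$P=\sum_{s\in\{-1,1\}^k}\hat{w}_s\, s s^T$$ for some weights $\hat w_s$ satisfying, for every $s\in\{-1,1\}^k$, $$\exp\!\left(\frac{s^Tf}{u}\right)\le\hat{w}_s\le(1+\epsilon)\exp\!\left(\frac{s^Tf}{u}\right),$$ in $\tilde{O}(k^4\rho'\epsilon^{-1})$ time.
   Context: $\tilde{O}(\cdot)$ hides polylogarithmic factors. The vector $f$ represents the flows of $k$ commodities along a single edge of capacity $u$.
   Formalization: The time bound is Õ(max(k^4 ρ'/ε, k^2)) instead of Õ(k^4 ρ'/ε), since the latter tends to 0 as ε grows or ρ' shrinks and cannot pay for writing the k×k matrix; the two agree when k^2 ρ' ≥ ε. Time is unit-cost exact real arithmetic. *)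

theory Defs
  imports Complex_Main "Jordan_Normal_Form.Matrix"
begin

text \<open>
  The computation model is a deterministic real RAM, presented as a structured imperative
  language.  Memory consists of named arrays of natural numbers and named arrays of real numbers,
  both addressed by computed indices; a scalar variable is cell 0 of an array.  Every operation
  has unit cost.  Real arithmetic is exact and limited to field operations and comparison: there
  is no rounding, no exponential function, and the only constants are integers.  Index arithmetic
  is limited to addition and (truncated) subtraction.
\<close>

type_synonym vname = string

record store =
  ints :: "vname \<Rightarrow> nat \<Rightarrow> nat"
  reals :: "vname \<Rightarrow> nat \<Rightarrow> real"

datatype iexp =
    IConst nat
  | ICell vname iexp
  | IAdd iexp iexp
  | ISub iexp iexp

datatype rexp =
    RConst int
  | RCell vname iexp
  | ROfNat iexp
  | RAdd rexp rexp
  | RSub rexp rexp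
  | RMul rexp rexp
  | RDiv rexp rexp

datatype bexp =
    ILess iexp iexp
  | RLess rexp rexp
  | BNot bexp
  | BAnd bexp bexp

datatype com =
    Skip
  | IAssign vname iexp iexp  \<comment> \<open>array, index, value\<close>
  | RAssign vname iexp rexp  \<comment> \<open>array, index, value\<close>
  | Seq com com
  | If bexp com com
  | While bexp com

primrec ival :: "iexp \<Rightarrow> store \<Rightarrow> nat" where
  "ival (IConst n) \<sigma> = n"
| "ival (ICell x e) \<sigma> = ints \<sigma> x (ival e \<sigma>)"
| "ival (IAdd a b) \<sigma> = ival a \<sigma> + ival b \<sigma>"
| "ival (ISub a b) \<sigma> = ival a \<sigma> - ival b \<sigma>"

primrec rval :: "rexp \<Rightarrow> store \<Rightarrow> real" where
  "rval (RConst c) \<sigma> = of_int c"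
| "rval (RCell x e) \<sigma> = reals \<sigma> x (ival e \<sigma>)"
| "rval (ROfNat e) \<sigma> = of_nat (ival e \<sigma>)"
| "rval (RAdd a b) \<sigma> = rval a \<sigma> + rval b \<sigma>"
| "rval (RSub a b) \<sigma> = rval a \<sigma> - rval b \<sigma>"
| "rval (RMul a b) \<sigma> = rval a \<sigma> * rval b \<sigma>"
| "rval (RDiv a b) \<sigma> = rval a \<sigma> / rval b \<sigma>"

primrec bval :: "bexp \<Rightarrow> store \<Rightarrow> bool" where
  "bval (ILess a b) \<sigma> \<longleftrightarrow> ival a \<sigma> < ival b \<sigma>"
| "bval (RLess a b) \<sigma> \<longleftrightarrow> rval a \<sigma> < rval b \<sigma>"
| "bval (BNot b) \<sigma> \<longleftrightarrow> \<not> bval b \<sigma>"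
| "bval (BAnd a b) \<sigma> \<longleftrightarrow> bval a \<sigma> \<and> bval b \<sigma>"

primrec icost :: "iexp \<Rightarrow> nat" where
  "icost (IConst n) = 1"
| "icost (ICell x e) = 1 + icost e"
| "icost (IAdd a b) = 1 + icost a + icost b"
| "icost (ISub a b) = 1 + icost a + icost b"

primrec rcost :: "rexp \<Rightarrow> nat" where
  "rcost (RConst c) = 1"
| "rcost (RCell x e) = 1 + icost e"
| "rcost (ROfNat e) = 1 + icost e"
| "rcost (RAdd a b) = 1 + rcost a + rcost b"
| "rcost (RSub a b) = 1 + rcost a + rcost b"
| "rcost (RMul a b) = 1 + rcost a + rcost b"
| "rcost (RDiv a b) = 1 + rcost a + rcost b"

primrec bcost :: "bexp \<Rightarrow> nat" where
  "bcost (ILess a b) = 1 + icost a + icost b"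
| "bcost (RLess a b) = 1 + rcost a + rcost b"
| "bcost (BNot b) = 1 + bcost b"
| "bcost (BAnd a b) = 1 + bcost a + bcost b"

definition iupd :: "vname \<Rightarrow> nat \<Rightarrow> nat \<Rightarrow> store \<Rightarrow> store" where
  "iupd x i v \<sigma> = \<sigma>\<lparr>ints := (ints \<sigma>)(x := (ints \<sigma> x)(i := v))\<rparr>"

definition rupd :: "vname \<Rightarrow> nat \<Rightarrow> real \<Rightarrow> store \<Rightarrow> store" where
  "rupd x i v \<sigma> = \<sigma>\<lparr>reals := (reals \<sigma>)(x := (reals \<sigma> x)(i := v))\<rparr>"

text \<open>\<open>exec c \<sigma> t \<tau>\<close>: started in \<open>\<sigma>\<close>, program \<open>c\<close> halts in \<open>\<tau>\<close> after exactly \<open>t\<close> steps.\<close>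

inductive exec :: "com \<Rightarrow> store \<Rightarrow> nat \<Rightarrow> store \<Rightarrow> bool" where
  Skip: "exec Skip \<sigma> 1 \<sigma>"
| IAssign: "exec (IAssign x i e) \<sigma> (1 + icost i + icost e) (iupd x (ival i \<sigma>) (ival e \<sigma>) \<sigma>)"
| RAssign: "exec (RAssign x i e) \<sigma> (1 + icost i + rcost e) (rupd x (ival i \<sigma>) (rval e \<sigma>) \<sigma>)"
| Seq: "exec c \<sigma> t1 \<sigma>' \<Longrightarrow> exec d \<sigma>' t2 \<tau> \<Longrightarrow> exec (Seq c d) \<sigma> (t1 + t2) \<tau>"
| IfTrue: "bval b \<sigma> \<Longrightarrow> exec c \<sigma> t \<tau> \<Longrightarrow> exec (If b c d) \<sigma> (1 + bcost b + t) \<tau>"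
| IfFalse: "\<not> bval b \<sigma> \<Longrightarrow> exec d \<sigma> t \<tau> \<Longrightarrow> exec (If b c d) \<sigma> (1 + bcost b + t) \<tau>"
| WhileFalse: "\<not> bval b \<sigma> \<Longrightarrow> exec (While b c) \<sigma> (1 + bcost b) \<sigma>"
| WhileTrue: "bval b \<sigma> \<Longrightarrow> exec c \<sigma> t1 \<sigma>' \<Longrightarrow> exec (While b c) \<sigma>' t2 \<tau> \<Longrightarrow>
    exec (While b c) \<sigma> (1 + bcost b + t1 + t2) \<tau>"

inductive_cases SkipE: "exec Skip \<sigma> t \<tau>"
inductive_cases IAssignE: "exec (IAssign x i e) \<sigma> t \<tau>"
inductive_cases RAssignE: "exec (RAssign x i r) \<sigma> t \<tau>"
inductive_cases SeqE: "exec (Seq c d) \<sigma> t \<tau>"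
inductive_cases IfE: "exec (If b c d) \<sigma> t \<tau>"
inductive_cases WhileE: "exec (While b c) \<sigma> t \<tau>"

lemma exec_deterministic:
  "exec c \<sigma> t \<tau> \<Longrightarrow> exec c \<sigma> t' \<tau>' \<Longrightarrow> t' = t \<and> \<tau>' = \<tau>"
proof (induction arbitrary: t' \<tau>' rule: exec.induct)
  case (Skip \<sigma>)
  from Skip.prems show ?case by (rule SkipE) simp
next
  case (IAssign x i e \<sigma>)
  from IAssign.prems show ?case by (rule IAssignE) simp
next
  case (RAssign x i e \<sigma>)
  from RAssign.prems show ?case by (rule RAssignE) simp
next
  case (Seq c \<sigma> t1 \<sigma>' d t2 \<tau>)
  from Seq.prems obtain r1 r2 \<sigma>'' where
    r: "t' = r1 + r2" "exec c \<sigma> r1 \<sigma>''" "exec d \<sigma>'' r2 \<tau>'" by (rule SeqE)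
  from Seq.IH(1)[OF r(2)] have e: "r1 = t1" "\<sigma>'' = \<sigma>'" by simp_all
  from Seq.IH(2)[OF r(3)[unfolded e]] show ?case using r(1) e(1) by simp
next
  case (IfTrue b \<sigma> c t \<tau> d)
  from IfTrue.prems obtain r where r: "t' = 1 + bcost b + r" "exec c \<sigma> r \<tau>'"
    by (rule IfE) (use IfTrue.hyps in simp_all)
  from IfTrue.IH[OF r(2)] show ?case using r(1) by simp
next
  case (IfFalse b \<sigma> d t \<tau> c)
  from IfFalse.prems obtain r where r: "t' = 1 + bcost b + r" "exec d \<sigma> r \<tau>'"
    by (rule IfE) (use IfFalse.hyps in simp_all)
  from IfFalse.IH[OF r(2)] show ?case using r(1) by simp
next
  case (WhileFalse b \<sigma> c)
  from WhileFalse.prems show ?case by (rule WhileE) (use WhileFalse.hyps in simp_all)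
next
  case (WhileTrue b \<sigma> c t1 \<sigma>' t2 \<tau>)
  from WhileTrue.prems obtain r1 r2 \<sigma>'' where
    r: "t' = 1 + bcost b + r1 + r2" "exec c \<sigma> r1 \<sigma>''" "exec (While b c) \<sigma>'' r2 \<tau>'"
    by (rule WhileE) (use WhileTrue.hyps in simp_all)
  from WhileTrue.IH(1)[OF r(2)] have e: "r1 = t1" "\<sigma>'' = \<sigma>'" by simp_all
  from WhileTrue.IH(2)[OF r(3)[unfolded e]] show ?case using r(1) e(1) by simp
qed

text \<open>All memory cells that do not hold input are initially 0.\<close>

definition input_store :: "nat \<Rightarrow> real \<Rightarrow> real \<Rightarrow> real \<Rightarrow> real vec \<Rightarrow> store" where
  "input_store k \<epsilon> u \<rho> f =
    \<lparr>ints = (\<lambda>x i. if x = ''k'' \<and> i = 0 then k else 0),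
     reals = (\<lambda>x i.
       if x = ''eps'' \<and> i = 0 then \<epsilon>
       else if x = ''u'' \<and> i = 0 then u
       else if x = ''rho'' \<and> i = 0 then \<rho>
       else if x = ''f'' \<and> i < k then f $ i
       else 0)\<rparr>"

text \<open>The output is read in row-major order from the real array named \<open>P\<close>.\<close>

definition output_mat :: "nat \<Rightarrow> store \<Rightarrow> real mat" where
  "output_mat k \<sigma> = mat k k (\<lambda>(i, j). reals \<sigma> ''P'' (i * k + j))"

definition l1_norm :: "real vec \<Rightarrow> real" where
  "l1_norm v = (\<Sum>i<dim_vec v. \<bar>v $ i\<bar>)"

definition sign_vecs :: "nat \<Rightarrow> real vec set" where
  "sign_vecs k = {s \<in> carrier_vec k. \<forall>i<k. s $ i \<in> {-1, 1}}"

definition weighted_outer_sum :: "nat \<Rightarrow> (real vec \<Rightarrow> real) \<Rightarrow> real mat" where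
  "weighted_outer_sum k w = mat k k (\<lambda>(i, j). \<Sum>s\<in>sign_vecs k. w s * (s $ i * s $ j))"

text \<open>The sum above ranges over a finite set, so it is not subject to the convention that sums
  over infinite sets vanish.\<close>

lemma finite_sign_vecs: "finite (sign_vecs k)"
proof -
  have "sign_vecs k \<subseteq> vec_of_list ` {xs. set xs \<subseteq> {-1, 1} \<and> length xs = k}"
  proof
    fix s assume s: "s \<in> sign_vecs k"
    then have "set (list_of_vec s) \<subseteq> {-1, 1}" "length (list_of_vec s) = k"
      by (auto simp: sign_vecs_def set_list_of_vec vec_set_def)
    moreover have "s = vec_of_list (list_of_vec s)"
      by (simp add: vec_list)
    ultimately show "s \<in> vec_of_list ` {xs. set xs \<subseteq> {-1, 1} \<and> length xs = k}"
      by blast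
  qed
  then show ?thesis
    by (rule finite_subset) (simp add: finite_lists_length_eq)
qed

text \<open>
  \<open>soft_O_bound C d k \<epsilon> \<rho> t\<close> is the bound that \<open>O~(k^4 \<rho> / \<epsilon>)\<close> places on a running time \<open>t\<close>, with
  leading constant \<open>C\<close> and polylogarithmic factor of degree \<open>d\<close> in \<open>k\<close>, \<open>\<rho>\<close>, \<open>1/\<epsilon>\<close>.  The maximum
  with \<open>k^2\<close>, the number of output entries, takes effect only if \<open>k^2 * \<rho> < \<epsilon>\<close>, when
  \<open>k^4 * \<rho> / \<epsilon>\<close> would not even pay for writing the output (and tends to 0 as \<open>\<epsilon>\<close> grows).
\<close>

definition soft_O_bound :: "real \<Rightarrow> nat \<Rightarrow> nat \<Rightarrow> real \<Rightarrow> real \<Rightarrow> nat \<Rightarrow> bool" where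
  "soft_O_bound C d k \<epsilon> \<rho> t \<longleftrightarrow>
    real t \<le> C * max (real k ^ 4 * \<rho> / \<epsilon>) (real k ^ 2) * ln (2 + real k + \<rho> + 1 / \<epsilon>) ^ d"

end

theory Submission
  imports Defs
begin

text \<open>
  Weights of product form \<open>w s = (\<Prod>l. g (s\<^sub>l * f\<^sub>l / u))\<close> make the sum over all \<open>2 ^ k\<close> sign vectors
  factor: every off-diagonal entry of the matrix is \<open>Q * T\<^sub>i * T\<^sub>j\<close> and every diagonal entry is \<open>Q\<close>,
  where \<open>Q = (\<Prod>l. g x\<^sub>l + g (- x\<^sub>l))\<close>, \<open>T\<^sub>l = (g x\<^sub>l - g (- x\<^sub>l)) / (g x\<^sub>l + g (- x\<^sub>l))\<close> and
  \<open>x\<^sub>l = f\<^sub>l / u\<close>.  With \<open>g x = (1 / (1 - x / 2 ^ m)) ^ 2 ^ m\<close>, computed by \<open>m\<close> squarings, one has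
  \<open>exp x \<le> g x \<le> exp (x + 2 * x\<^sup>2 / 2 ^ m)\<close>.  Since the squares of the \<open>x\<^sub>l\<close> sum to at most \<open>\<rho>\<^sup>2\<close>,
  some \<open>m = O (log (2 + \<rho> + 1 / \<epsilon>))\<close> keeps the total error below \<open>1 + \<epsilon>\<close>, and the running time is
  \<open>O (k\<^sup>2 + k * m)\<close>.
\<close>

section \<open>Running time of programs\<close>

text \<open>Total correctness with an upper bound on the time instead of the exact time, so that
  budgets can be rounded up freely. As \<open>exec\<close> is deterministic, one run tells
  everything.\<close>

definition runs :: "com \<Rightarrow> store \<Rightarrow> nat \<Rightarrow> (store \<Rightarrow> bool) \<Rightarrow> bool" where
  "runs c \<sigma> n Q \<longleftrightarrow> (\<exists>t \<tau>. exec c \<sigma> t \<tau> \<and> t \<le> n \<and> Q \<tau>)"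

lemma runs_mono:
  assumes "runs c \<sigma> m P" "m \<le> n" "\<And>\<tau>. P \<tau> \<Longrightarrow> Q \<tau>"
  shows "runs c \<sigma> n Q"
  using assms unfolding runs_def by (meson order_trans)

lemma runs_exec:
  assumes "exec c \<sigma> t \<tau>"
  shows "runs c \<sigma> n Q \<longleftrightarrow> t \<le> n \<and> Q \<tau>"
  using assms exec_deterministic[OF assms] unfolding runs_def by metis

lemma runs_Seq:
  assumes "runs c \<sigma> m (\<lambda>\<tau>. runs d \<tau> n Q)"
  shows "runs (Seq c d) \<sigma> (m + n) Q"
  using assms unfolding runs_def by (meson exec.Seq add_mono)

text \<open>Determinism makes this an equivalence, so for assignments it serves as a rewrite rule:
  simplification executes straight-line code and pays for it out of \<open>n\<close>.\<close>

lemma runs_Seq_exec: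
  assumes c: "exec c \<sigma> t \<sigma>'"
  shows "runs (Seq c d) \<sigma> n Q \<longleftrightarrow> t \<le> n \<and> runs d \<sigma>' (n - t) Q"
proof
  assume "runs (Seq c d) \<sigma> n Q"
  then obtain r \<tau> where r: "exec (Seq c d) \<sigma> r \<tau>" "r \<le> n" "Q \<tau>"
    unfolding runs_def by blast
  from r(1) obtain t1 t2 \<sigma>1 where "r = t1 + t2" "exec c \<sigma> t1 \<sigma>1" "exec d \<sigma>1 t2 \<tau>"
    by (rule SeqE)
  with exec_deterministic[OF c] have "r = t + t2" "exec d \<sigma>' t2 \<tau>" by auto
  with r show "t \<le> n \<and> runs d \<sigma>' (n - t) Q"
    unfolding runs_def by (intro conjI exI[of _ t2] exI[of _ \<tau>]) auto
next
  assume r: "t \<le> n \<and> runs d \<sigma>' (n - t) Q"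
  then have "runs c \<sigma> t (\<lambda>\<tau>. runs d \<tau> (n - t) Q)"
    by (simp add: runs_exec[OF c])
  from runs_Seq[OF this] r show "runs (Seq c d) \<sigma> n Q" by simp
qed

lemmas runs_assign [simp] = runs_exec[OF exec.IAssign] runs_exec[OF exec.RAssign]
  runs_Seq_exec[OF exec.IAssign] runs_Seq_exec[OF exec.RAssign]

text \<open>The continuation \<open>e\<close> is pushed into both branches, which avoids a
  postcondition for the conditional alone.\<close>

lemma runs_Seq_If:
  assumes "bval b \<sigma> \<Longrightarrow> runs (Seq c e) \<sigma> n Q" "\<not> bval b \<sigma> \<Longrightarrow> runs (Seq d e) \<sigma> n Q"
  shows "runs (Seq (If b c d) e) \<sigma> (1 + bcost b + n) Q"
proof (cases "bval b \<sigma>")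
  case True
  from assms(1)[OF this] obtain t \<tau> where "exec (Seq c e) \<sigma> t \<tau>" "t \<le> n" "Q \<tau>"
    unfolding runs_def by blast
  moreover from this(1) obtain t1 t2 \<sigma>' where "t = t1 + t2" "exec c \<sigma> t1 \<sigma>'" "exec e \<sigma>' t2 \<tau>"
    by (rule SeqE)
  moreover from this(2,3) have "exec (Seq (If b c d) e) \<sigma> ((1 + bcost b + t1) + t2) \<tau>"
    by (intro exec.Seq exec.IfTrue True)
  ultimately show ?thesis unfolding runs_def
    by (intro exI[of _ "(1 + bcost b + t1) + t2"] exI[of _ \<tau>]) auto
next
  case False
  from assms(2)[OF this] obtain t \<tau> where "exec (Seq d e) \<sigma> t \<tau>" "t \<le> n" "Q \<tau>"
    unfolding runs_def by blast
  moreover from this(1) obtain t1 t2 \<sigma>' where "t = t1 + t2" "exec d \<sigma> t1 \<sigma>'" "exec e \<sigma>' t2 \<tau>"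
    by (rule SeqE)
  moreover from this(2,3) have "exec (Seq (If b c d) e) \<sigma> ((1 + bcost b + t1) + t2) \<tau>"
    by (intro exec.Seq exec.IfFalse False)
  ultimately show ?thesis unfolding runs_def
    by (intro exI[of _ "(1 + bcost b + t1) + t2"] exI[of _ \<tau>]) auto
qed

text \<open>\<open>I\<close> is indexed by the number of completed iterations, of which there are
  exactly \<open>n\<close>; the last summand of the budget pays for the failing test.\<close>

lemma runs_While:
  assumes I0: "I 0 \<sigma>"
    and body: "\<And>i \<tau>. i < n \<Longrightarrow> I i \<tau> \<Longrightarrow> bval b \<tau> \<and> runs c \<tau> B (I (Suc i))"
    and exit: "\<And>\<tau>. I n \<tau> \<Longrightarrow> \<not> bval b \<tau>"
  shows "runs (While b c) \<sigma> (n * (1 + bcost b + B) + (1 + bcost b)) (I n)"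
proof -
  have "runs (While b c) \<tau> (j * (1 + bcost b + B) + (1 + bcost b)) (I n)"
    if "j \<le> n" "I (n - j) \<tau>" for j \<tau>
    using that
  proof (induction j arbitrary: \<tau>)
    case 0
    then show ?case using exit[of \<tau>] exec.WhileFalse[of b \<tau> c] unfolding runs_def by auto
  next
    case (Suc j)
    from body[of "n - Suc j" \<tau>] Suc.prems have b: "bval b \<tau>"
      and "runs c \<tau> B (I (n - j))" by (auto simp: Suc_diff_Suc)
    then obtain t1 \<tau>1 where 1: "exec c \<tau> t1 \<tau>1" "t1 \<le> B" "I (n - j) \<tau>1"
      unfolding runs_def by blast
    from Suc.IH[OF _ 1(3)] Suc.prems obtain t2 \<tau>2 where
      2: "exec (While b c) \<tau>1 t2 \<tau>2" "t2 \<le> j * (1 + bcost b + B) + (1 + bcost b)" "I n \<tau>2"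
      unfolding runs_def by auto
    from exec.WhileTrue[OF b 1(1) 2(1)] show ?case unfolding runs_def
      using 1(2) 2(2,3) by (intro exI[of _ "1 + bcost b + t1 + t2"] exI[of _ \<tau>2]) auto
  qed
  from this[of n] I0 show ?thesis by simp
qed

lemma ints_iupd [simp]: "ints (iupd x i v \<sigma>) = (ints \<sigma>)(x := (ints \<sigma> x)(i := v))"
  and reals_iupd [simp]: "reals (iupd x i v \<sigma>) = reals \<sigma>"
  and ints_rupd [simp]: "ints (rupd x i r \<sigma>) = ints \<sigma>"
  and reals_rupd [simp]: "reals (rupd x i r \<sigma>) = (reals \<sigma>)(x := (reals \<sigma> x)(i := r))"
  by (simp_all add: iupd_def rupd_def)

section \<open>The program\<close>

abbreviation IVar :: "vname \<Rightarrow> iexp" where "IVar x \<equiv> ICell x (IConst 0)"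
abbreviation RVar :: "vname \<Rightarrow> rexp" where "RVar x \<equiv> RCell x (IConst 0)"
abbreviation ISet :: "vname \<Rightarrow> iexp \<Rightarrow> com" where "ISet x \<equiv> IAssign x (IConst 0)"
abbreviation RSet :: "vname \<Rightarrow> rexp \<Rightarrow> com" where "RSet x \<equiv> RAssign x (IConst 0)"
abbreviation incr :: "vname \<Rightarrow> com" where "incr x \<equiv> ISet x (IAdd (IVar x) (IConst 1))"

definition doubling :: com where
  "doubling = While (RLess (RVar ''N'') (RVar ''M''))
     (Seq (RSet ''N'' (RAdd (RVar ''N'') (RVar ''N''))) (incr ''m''))"

definition squaring :: com where
  "squaring = While (ILess (IVar ''j'') (IVar ''m''))
     (Seq (RSet ''a'' (RMul (RVar ''a'') (RVar ''a'')))
     (Seq (RSet ''b'' (RMul (RVar ''b'') (RVar ''b''))) (incr ''j'')))"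

definition factors :: com where
  "factors = While (ILess (IVar ''i'') (IVar ''k''))
     (Seq (RSet ''y'' (RDiv (RCell ''f'' (IVar ''i'')) (RMul (RVar ''u'') (RVar ''N''))))
     (Seq (RSet ''a'' (RDiv (RConst 1) (RSub (RConst 1) (RVar ''y''))))
     (Seq (RSet ''b'' (RDiv (RConst 1) (RAdd (RConst 1) (RVar ''y''))))
     (Seq (ISet ''j'' (IConst 0))
     (Seq squaring
     (Seq (RSet ''Q'' (RMul (RVar ''Q'') (RAdd (RVar ''a'') (RVar ''b''))))
     (Seq (RAssign ''T'' (IVar ''i'')
             (RDiv (RSub (RVar ''a'') (RVar ''b'')) (RAdd (RVar ''a'') (RVar ''b''))))
          (incr ''i''))))))))"

text \<open>Index arithmetic has no multiplication, so the address \<open>i * k + j\<close> is kept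
  as a running counter \<open>p\<close>. Equality of \<open>i\<close> and \<open>j\<close> is
  expressed by two negated comparisons.\<close>

definition row :: com where
  "row = While (ILess (IVar ''j'') (IVar ''k''))
     (Seq (If (BAnd (BNot (ILess (IVar ''i'') (IVar ''j''))) (BNot (ILess (IVar ''j'') (IVar ''i''))))
             (RAssign ''P'' (IVar ''p'') (RVar ''Q''))
             (RAssign ''P'' (IVar ''p'')
               (RMul (RVar ''Q'') (RMul (RCell ''T'' (IVar ''i'')) (RCell ''T'' (IVar ''j''))))))
     (Seq (incr ''p'') (incr ''j'')))"

definition rows :: com where
  "rows = While (ILess (IVar ''i'') (IVar ''k''))
     (Seq (ISet ''j'' (IConst 0)) (Seq row (incr ''i'')))"

text \<open>The counters \<open>m\<close>, \<open>i\<close> and \<open>p\<close> start at 0 because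
  non-input memory is zero. \<open>M\<close> receives the value
  \<open>M_bound \<epsilon> \<rho>\<close>.\<close>

definition prog :: com where
  "prog =
     Seq (RSet ''N'' (RConst 1))
    (Seq (RSet ''M'' (RAdd (RMul (RConst 2) (RVar ''rho''))
            (RMul (RMul (RConst 2) (RMul (RVar ''rho'') (RVar ''rho'')))
                  (RAdd (RConst 1) (RDiv (RConst 1) (RVar ''eps''))))))
    (Seq doubling
    (Seq (RSet ''Q'' (RConst 1))
    (Seq factors
    (Seq (ISet ''i'' (IConst 0))
         rows)))))"

text \<open>\<open>2 ^ m \<ge> M_bound \<epsilon> \<rho>\<close> gives both \<open>\<bar>x\<^sub>l\<bar> / 2 ^ m \<le> 1 / 2\<close> and
  \<open>2 * \<rho>\<^sup>2 / 2 ^ m \<le> \<epsilon> / (1 + \<epsilon>) \<le> ln (1 + \<epsilon>)\<close>.\<close>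

definition M_bound :: "real \<Rightarrow> real \<Rightarrow> real" where
  "M_bound \<epsilon> \<rho> = 2 * \<rho> + 2 * (\<rho> * \<rho>) * (1 + 1 / \<epsilon>)"

definition log_steps :: "real \<Rightarrow> real \<Rightarrow> nat" where
  "log_steps \<epsilon> \<rho> = (LEAST m. M_bound \<epsilon> \<rho> \<le> 2 ^ m)"

text \<open>The base is \<open>1 / (1 - y)\<close> rather than \<open>1 + y\<close> because
  \<open>1 - y \<le> exp (- y)\<close> makes it err upwards for \<open>y < 1\<close>, as the lower
  bound on the weights demands.\<close>

definition approx_exp :: "nat \<Rightarrow> real \<Rightarrow> real" where
  "approx_exp m x = (1 / (1 - x / 2 ^ m)) ^ 2 ^ m"

text \<open>With the true exponential, this and \<open>ratio_factor\<close> would be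
  \<open>2 * cosh x\<close> and \<open>tanh x\<close>.\<close>

definition plus_factor :: "nat \<Rightarrow> real \<Rightarrow> real" where
  "plus_factor m x = approx_exp m x + approx_exp m (- x)"

definition ratio_factor :: "nat \<Rightarrow> real \<Rightarrow> real" where
  "ratio_factor m x = (approx_exp m x - approx_exp m (- x)) / plus_factor m x"

text \<open>The index \<open>q = i * k + j\<close> encodes the matrix position \<open>(i, j)\<close> in row-major order.\<close>

definition entry :: "nat \<Rightarrow> real \<Rightarrow> (nat \<Rightarrow> real) \<Rightarrow> nat \<Rightarrow> real" where
  "entry k Q T q = (if q div k = q mod k then Q else Q * (T (q div k) * T (q mod k)))"

section \<open>Correctness of the program\<close>

lemma doubling_runs:
  assumes M: "M = M_bound \<epsilon> \<rho>"
    and least: "m = log_steps \<epsilon> \<rho>" and bd: "M \<le> 2 ^ m"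
    and \<sigma>: "reals \<sigma> ''N'' 0 = 1" "reals \<sigma> ''M'' 0 = M" "ints \<sigma> ''m'' 0 = 0"
  shows "runs doubling \<sigma> (20 * m + 10) (\<lambda>\<tau>.
     reals \<tau> ''N'' 0 = 2 ^ m \<and> ints \<tau> ''m'' 0 = m \<and>
     (\<forall>x. x \<noteq> ''N'' \<longrightarrow> reals \<tau> x = reals \<sigma> x) \<and> (\<forall>x. x \<noteq> ''m'' \<longrightarrow> ints \<tau> x = ints \<sigma> x))"
proof -
  let ?I = "\<lambda>i \<tau>. reals \<tau> ''N'' 0 = 2 ^ i \<and> ints \<tau> ''m'' 0 = i \<and>
     (\<forall>x. x \<noteq> ''N'' \<longrightarrow> reals \<tau> x = reals \<sigma> x) \<and> (\<forall>x. x \<noteq> ''m'' \<longrightarrow> ints \<tau> x = ints \<sigma> x)"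
  \<comment> \<open>Minimality of \<open>log_steps\<close> keeps the guard true for the first
    \<open>m\<close> tests, so the loop makes exactly \<open>m\<close> iterations. The 14 below is a
    rounded-up cost of the body.\<close>
  have "2 ^ i < M" if "i < m" for i
    using not_less_Least that unfolding least log_steps_def M by (metis not_le)
  then have "runs doubling \<sigma>
      (m * (1 + bcost (RLess (RVar ''N'') (RVar ''M'')) + 14) + (1 + bcost (RLess (RVar ''N'') (RVar ''M'')))) (?I m)"
    unfolding doubling_def using \<sigma> bd by (intro runs_While[where I = ?I]) auto
  then show ?thesis by (rule runs_mono) auto
qed

lemma squaring_runs:
  assumes "ints \<sigma> ''m'' 0 = m" "ints \<sigma> ''j'' 0 = 0"
  shows "runs squaring \<sigma> (50 * m + 10) (\<lambda>\<tau>.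
     reals \<tau> ''a'' 0 = reals \<sigma> ''a'' 0 ^ 2 ^ m \<and> reals \<tau> ''b'' 0 = reals \<sigma> ''b'' 0 ^ 2 ^ m \<and>
     (\<forall>x. x \<noteq> ''a'' \<longrightarrow> x \<noteq> ''b'' \<longrightarrow> reals \<tau> x = reals \<sigma> x) \<and>
     (\<forall>x. x \<noteq> ''j'' \<longrightarrow> ints \<tau> x = ints \<sigma> x))"
proof -
  let ?I = "\<lambda>i \<tau>. reals \<tau> ''a'' 0 = reals \<sigma> ''a'' 0 ^ 2 ^ i \<and>
     reals \<tau> ''b'' 0 = reals \<sigma> ''b'' 0 ^ 2 ^ i \<and> ints \<tau> ''j'' 0 = i \<and>
     (\<forall>x. x \<noteq> ''a'' \<longrightarrow> x \<noteq> ''b'' \<longrightarrow> reals \<tau> x = reals \<sigma> x) \<and>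
     (\<forall>x. x \<noteq> ''j'' \<longrightarrow> ints \<tau> x = ints \<sigma> x)"
  have "runs squaring \<sigma>
      (m * (1 + bcost (ILess (IVar ''j'') (IVar ''m'')) + 40) + (1 + bcost (ILess (IVar ''j'') (IVar ''m'')))) (?I m)"
    unfolding squaring_def using assms
    by (intro runs_While[where I = ?I]) (auto simp: power_add[symmetric] mult_2)
  then show ?thesis by (rule runs_mono) auto
qed

lemma factors_runs:
  fixes f :: "nat \<Rightarrow> real"
  assumes \<sigma>: "ints \<sigma> ''k'' 0 = k" "ints \<sigma> ''m'' 0 = m" "ints \<sigma> ''i'' 0 = 0"
    "reals \<sigma> ''u'' 0 = u" "reals \<sigma> ''N'' 0 = 2 ^ m" "reals \<sigma> ''f'' = f" "reals \<sigma> ''Q'' 0 = 1"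
  shows "runs factors \<sigma> (k * (50 * m + 116) + 10) (\<lambda>\<tau>.
     ints \<tau> ''k'' 0 = k \<and> ints \<tau> ''p'' = ints \<sigma> ''p'' \<and>
     reals \<tau> ''Q'' 0 = (\<Prod>l<k. plus_factor m (f l / u)) \<and>
     (\<forall>l<k. reals \<tau> ''T'' l = ratio_factor m (f l / u)))"
proof -
  let ?I = "\<lambda>i \<tau>. ints \<tau> ''k'' 0 = k \<and> ints \<tau> ''m'' 0 = m \<and> ints \<tau> ''i'' 0 = i \<and>
     ints \<tau> ''p'' = ints \<sigma> ''p'' \<and>
     reals \<tau> ''u'' 0 = u \<and> reals \<tau> ''N'' 0 = 2 ^ m \<and> reals \<tau> ''f'' = f \<and>
     reals \<tau> ''Q'' 0 = (\<Prod>l<i. plus_factor m (f l / u)) \<and>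
     (\<forall>l<i. reals \<tau> ''T'' l = ratio_factor m (f l / u))"
  let ?rest = "Seq (RSet ''Q'' (RMul (RVar ''Q'') (RAdd (RVar ''a'') (RVar ''b''))))
     (Seq (RAssign ''T'' (IVar ''i'')
             (RDiv (RSub (RVar ''a'') (RVar ''b'')) (RAdd (RVar ''a'') (RVar ''b''))))
          (incr ''i''))"
  have "runs factors \<sigma>
      (k * (1 + bcost (ILess (IVar ''i'') (IVar ''k'')) + (50 * m + 110)) + (1 + bcost (ILess (IVar ''i'') (IVar ''k'')))) (?I k)"
    unfolding factors_def
  proof (rule runs_While[where I = ?I], goal_cases)
    case 1
    then show ?case using \<sigma> by simp
  next
    case (2 i \<tau>)
    \<comment> \<open>The part of the body from \<open>squaring\<close> on, started in any store
      that the four preceding assignments can produce.\<close>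
    have sq: "runs (Seq squaring ?rest) \<tau>' ((50 * m + 10) + 50) (?I (Suc i))"
      if "ints \<tau>' ''j'' 0 = 0" "\<And>x. x \<noteq> ''j'' \<Longrightarrow> ints \<tau>' x = ints \<tau> x"
        "\<And>x. x \<notin> {''y'', ''a'', ''b''} \<Longrightarrow> reals \<tau>' x = reals \<tau> x"
        "reals \<tau>' ''a'' 0 = 1 / (1 - f i / (u * 2 ^ m))"
        "reals \<tau>' ''b'' 0 = 1 / (1 + f i / (u * 2 ^ m))" for \<tau>'
    proof (rule runs_Seq, rule runs_mono[OF squaring_runs[of _ m] order_refl], goal_cases)
      case (3 \<tau>2)
      \<comment> \<open>Here \<open>f i / (u * 2 ^ m)\<close> is read as
        \<open>(f i / u) / 2 ^ m\<close>, the scaled argument in \<open>approx_exp\<close>.\<close>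
      have "reals \<tau>2 ''a'' 0 = approx_exp m (f i / u)" "reals \<tau>2 ''b'' 0 = approx_exp m (- (f i / u))"
        using 3 that by (simp_all add: approx_exp_def)
      then show ?case using 3 that 2
        by (auto simp: plus_factor_def ratio_factor_def less_Suc_eq)
    qed (use that 2 in auto)
    show ?case
      by (intro conjI runs_assign(3,4)[THEN iffD2] runs_mono[OF sq])
         (use 2 in \<open>simp_all add: fun_eq_iff\<close>)
  next
    case (3 \<tau>)
    then show ?case by simp
  qed
  then show ?thesis by (rule runs_mono) (auto simp: algebra_simps)
qed

lemma row_runs:
  assumes \<sigma>: "ints \<sigma> ''k'' 0 = k" "ints \<sigma> ''i'' 0 = i" "ints \<sigma> ''j'' 0 = 0" "ints \<sigma> ''p'' 0 = i * k"
    "reals \<sigma> ''Q'' 0 = Q" "\<And>l. l < k \<Longrightarrow> reals \<sigma> ''T'' l = T l" "i < k"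
    "\<And>q. q < i * k \<Longrightarrow> reals \<sigma> ''P'' q = entry k Q T q"
  shows "runs row \<sigma> (60 * k + 10) (\<lambda>\<tau>.
     ints \<tau> ''p'' 0 = Suc i * k \<and> (\<forall>q < Suc i * k. reals \<tau> ''P'' q = entry k Q T q) \<and>
     (\<forall>x. x \<noteq> ''P'' \<longrightarrow> reals \<tau> x = reals \<sigma> x) \<and>
     (\<forall>x. x \<noteq> ''j'' \<longrightarrow> x \<noteq> ''p'' \<longrightarrow> ints \<tau> x = ints \<sigma> x))"
proof -
  let ?I = "\<lambda>j \<tau>. ints \<tau> ''j'' 0 = j \<and> ints \<tau> ''p'' 0 = i * k + j \<and>
     (\<forall>q < i * k + j. reals \<tau> ''P'' q = entry k Q T q) \<and>
     (\<forall>x. x \<noteq> ''P'' \<longrightarrow> reals \<tau> x = reals \<sigma> x) \<and>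
     (\<forall>x. x \<noteq> ''j'' \<longrightarrow> x \<noteq> ''p'' \<longrightarrow> ints \<tau> x = ints \<sigma> x)"
  have e: "entry k Q T (i * k + j) = (if i = j then Q else Q * (T i * T j))" if "j < k" for j
    using that by (simp add: entry_def)
  have "runs row \<sigma>
      (k * (1 + bcost (ILess (IVar ''j'') (IVar ''k'')) + (1 + bcost (BAnd (BNot (ILess (IVar ''i'') (IVar ''j''))) (BNot (ILess (IVar ''j'') (IVar ''i'')))) + 35)) + (1 + bcost (ILess (IVar ''j'') (IVar ''k'')))) (?I k)"
    unfolding row_def
  proof (rule runs_While[where I = ?I], goal_cases)
    case 1
    then show ?case using \<sigma> by simp
  next
    case (2 j \<tau>)
    show ?case
      by (intro conjI runs_Seq_If) (use 2 \<sigma> in \<open>auto simp: e less_Suc_eq\<close>)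
  next
    case (3 \<tau>)
    then show ?case using \<sigma> by simp
  qed
  then show ?thesis by (rule runs_mono) (auto simp: add.commute)
qed

lemma rows_runs:
  assumes \<sigma>: "ints \<sigma> ''k'' 0 = k" "ints \<sigma> ''i'' 0 = 0" "ints \<sigma> ''p'' 0 = 0"
    "reals \<sigma> ''Q'' 0 = Q" "\<And>l. l < k \<Longrightarrow> reals \<sigma> ''T'' l = T l"
  shows "runs rows \<sigma> (k * (60 * k + 36) + 10) (\<lambda>\<tau>. \<forall>q < k * k. reals \<tau> ''P'' q = entry k Q T q)"
proof -
  let ?I = "\<lambda>i \<tau>. ints \<tau> ''k'' 0 = k \<and> ints \<tau> ''i'' 0 = i \<and> ints \<tau> ''p'' 0 = i * k \<and>
     reals \<tau> ''Q'' 0 = Q \<and> (\<forall>l<k. reals \<tau> ''T'' l = T l) \<and>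
     (\<forall>q < i * k. reals \<tau> ''P'' q = entry k Q T q)"
  have "runs rows \<sigma>
      (k * (1 + bcost (ILess (IVar ''i'') (IVar ''k'')) + (60 * k + 30)) + (1 + bcost (ILess (IVar ''i'') (IVar ''k'')))) (?I k)"
    unfolding rows_def
  proof (rule runs_While[where I = ?I], goal_cases)
    case 1
    then show ?case using \<sigma> by simp
  next
    case (2 i \<tau>)
    have "runs (Seq row (incr ''i'')) (iupd ''j'' 0 0 \<tau>) ((60 * k + 10) + 10) (?I (Suc i))"
      by (rule runs_Seq, rule runs_mono[OF row_runs[of _ k i Q T] order_refl]) (use 2 in auto)
    then show ?case using 2 by (auto intro: runs_mono)
  next
    case (3 \<tau>)
    then show ?case by simp
  qed
  then show ?thesis by (rule runs_mono) (auto simp: algebra_simps)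
qed


section \<open>Accuracy of the weights\<close>

text \<open>For \<open>y = x / 2 ^ m\<close> with \<open>\<bar>y\<bar> \<le> 1 / 2\<close> one has
  \<open>y \<le> - ln (1 - y) \<le> y + 2 * y\<^sup>2\<close>. Multiplying by \<open>2 ^ m\<close>
  leaves an error of only \<open>2 * x\<^sup>2 / 2 ^ m\<close> in the exponent.\<close>

lemma approx_exp_bounds:
  fixes x :: real
  assumes "2 * \<bar>x\<bar> \<le> 2 ^ m"
  shows "exp x \<le> approx_exp m x" "approx_exp m x \<le> exp (x + 2 * x\<^sup>2 / 2 ^ m)"
proof -
  define y where "y = x / 2 ^ m"
  have y: "\<bar>- y\<bar> \<le> 1 / 2" using assms by (simp add: y_def abs_mult field_simps)
  then have pos: "1 - y > 0" by linarith
  have ln: "- (2 ^ m) * ln (1 - y) = ln (approx_exp m x)"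
    using pos by (simp add: approx_exp_def ln_realpow ln_div flip: y_def)
  have ap: "approx_exp m x > 0" using pos by (simp add: approx_exp_def flip: y_def)
  have "ln (1 - y) \<le> - y" using ln_le_minus_one[OF pos] by simp
  then have "2 ^ m * ln (1 - y) \<le> 2 ^ m * - y" by (intro mult_left_mono) auto
  then have "x \<le> ln (approx_exp m x)" by (simp add: y_def flip: ln)
  then show "exp x \<le> approx_exp m x" using ap by (simp add: ln_ge_iff)
  have "- ln (1 - y) \<le> y + 2 * y\<^sup>2"
    using abs_ln_one_plus_x_minus_x_bound[OF y] by simp
  then have "2 ^ m * - ln (1 - y) \<le> 2 ^ m * (y + 2 * y\<^sup>2)" by (intro mult_left_mono) auto
  also have "\<dots> = x + 2 * x\<^sup>2 / 2 ^ m" by (simp add: y_def field_simps power2_eq_square)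
  finally have "ln (approx_exp m x) \<le> x + 2 * x\<^sup>2 / 2 ^ m" by (simp flip: ln)
  then show "approx_exp m x \<le> exp (x + 2 * x\<^sup>2 / 2 ^ m)" using ap
    by (metis exp_le_cancel_iff exp_ln)
qed

text \<open>The errors of the factors add up in the exponent. The numbers \<open>y l\<close> are
  arbitrary so that the bounds apply to \<open>s $ l * x l\<close> for every sign vector
  \<open>s\<close> with the same \<open>m\<close>.\<close>

lemma prod_approx_exp_bounds:
  fixes y :: "nat \<Rightarrow> real"
  assumes \<epsilon>: "\<epsilon> > 0" and y: "(\<Sum>l<k. \<bar>y l\<bar>) \<le> \<rho>" and m: "M_bound \<epsilon> \<rho> \<le> 2 ^ m"
  shows "exp (\<Sum>l<k. y l) \<le> (\<Prod>l<k. approx_exp m (y l))"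
    "(\<Prod>l<k. approx_exp m (y l)) \<le> (1 + \<epsilon>) * exp (\<Sum>l<k. y l)"
proof -
  have \<rho>: "\<rho> \<ge> 0" using y by (meson abs_ge_zero order_trans sum_nonneg)
  have yl: "\<bar>y l\<bar> \<le> \<rho>" if "l < k" for l
    using member_le_sum[of l "{..<k}" "\<lambda>l. \<bar>y l\<bar>"] that y by auto
  have "2 * \<rho> \<le> M_bound \<epsilon> \<rho>" using \<epsilon> \<rho> by (simp add: M_bound_def)
  then have le: "2 * \<bar>y l\<bar> \<le> 2 ^ m" if "l < k" for l using yl[OF that] m by linarith
  show "exp (\<Sum>l<k. y l) \<le> (\<Prod>l<k. approx_exp m (y l))"
    unfolding exp_sum[OF finite_lessThan] using approx_exp_bounds(1)[OF le]
    by (intro prod_mono) auto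
  \<comment> \<open>One factor of each square is bounded by \<open>\<rho>\<close>, the remaining
    absolute values sum to at most \<open>\<rho>\<close>.\<close>
  have sq: "(\<Sum>l<k. (y l)\<^sup>2) \<le> \<rho>\<^sup>2"
  proof -
    have "(\<Sum>l<k. (y l)\<^sup>2) \<le> (\<Sum>l<k. \<rho> * \<bar>y l\<bar>)"
    proof (rule sum_mono)
      fix l assume "l \<in> {..<k}"
      then have "\<bar>y l\<bar> * \<bar>y l\<bar> \<le> \<rho> * \<bar>y l\<bar>" by (intro mult_right_mono yl) auto
      then show "(y l)\<^sup>2 \<le> \<rho> * \<bar>y l\<bar>" by (simp add: power2_eq_square)
    qed
    also have "\<dots> \<le> \<rho> * \<rho>" using y \<rho> by (simp add: mult_left_mono flip: sum_distrib_left)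
    finally show ?thesis by (simp add: power2_eq_square)
  qed
  \<comment> \<open>The lower bound
    \<open>\<epsilon> / (1 + \<epsilon>) \<le> ln (1 + \<epsilon>)\<close> is
    \<open>ln z \<le> z - 1\<close> at \<open>z = 1 / (1 + \<epsilon>)\<close>.\<close>
  have err: "2 * \<rho>\<^sup>2 / 2 ^ m \<le> ln (1 + \<epsilon>)"
  proof -
    have "2 * \<rho>\<^sup>2 * (1 + 1 / \<epsilon>) \<le> 2 ^ m"
      using m \<rho> by (simp add: M_bound_def power2_eq_square)
    then have "2 * \<rho>\<^sup>2 * (1 + \<epsilon>) \<le> 2 ^ m * \<epsilon>" using \<epsilon> by (simp add: field_simps)
    then have "2 * \<rho>\<^sup>2 / 2 ^ m \<le> \<epsilon> / (1 + \<epsilon>)" using \<epsilon> by (simp add: field_simps)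
    also have "\<dots> = - (1 / (1 + \<epsilon>) - 1)" using \<epsilon> by (simp add: field_simps)
    also have "\<dots> \<le> - ln (1 / (1 + \<epsilon>))"
      using ln_le_minus_one[of "1 / (1 + \<epsilon>)"] \<epsilon> by simp
    also have "\<dots> = ln (1 + \<epsilon>)" using \<epsilon> by (simp add: ln_div)
    finally show ?thesis .
  qed
  have "(\<Prod>l<k. approx_exp m (y l)) \<le> (\<Prod>l<k. exp (y l + 2 * (y l)\<^sup>2 / 2 ^ m))"
    using approx_exp_bounds[OF le] by (intro prod_mono) (auto intro: order_trans[OF exp_ge_zero])
  also have "\<dots> = exp ((\<Sum>l<k. y l) + 2 * (\<Sum>l<k. (y l)\<^sup>2) / 2 ^ m)"
    by (simp add: sum.distrib sum_distrib_left sum_divide_distrib flip: exp_sum)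
  also have "\<dots> \<le> exp ((\<Sum>l<k. y l) + ln (1 + \<epsilon>))"
    using err divide_right_mono[of "2 * (\<Sum>l<k. (y l)\<^sup>2)" "2 * \<rho>\<^sup>2" "2 ^ m"] sq by simp
  also have "\<dots> = (1 + \<epsilon>) * exp (\<Sum>l<k. y l)" using \<epsilon> by (simp add: exp_add)
  finally show "(\<Prod>l<k. approx_exp m (y l)) \<le> (1 + \<epsilon>) * exp (\<Sum>l<k. y l)" .
qed

section \<open>The weighted sum of outer products\<close>

text \<open>Expanding the product chooses a summand for each \<open>l\<close>; the set
  \<open>X\<close> of indices where the first is chosen corresponds to the sign vector that is 1
  exactly on \<open>X\<close>.\<close>

lemma sum_sign_vecs_prod:
  fixes h :: "nat \<Rightarrow> real \<Rightarrow> 'a :: comm_ring_1"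
  shows "(\<Sum>s\<in>sign_vecs k. \<Prod>l<k. h l (s $ l)) = (\<Prod>l<k. h l 1 + h l (-1))"
proof -
  have "(\<Prod>l<k. h l 1 + h l (-1)) =
      (\<Sum>X\<in>Pow {..<k}. (\<Prod>l\<in>X. h l 1) * (\<Prod>l\<in>{..<k} - X. h l (-1)))"
    by (rule prod_add) simp
  also have "\<dots> = (\<Sum>s\<in>sign_vecs k. \<Prod>l<k. h l (s $ l))"
  proof (rule sum.reindex_bij_witness[where i = "\<lambda>s. {l. l < k \<and> s $ l = 1}"
        and j = "\<lambda>X. vec k (\<lambda>l. if l \<in> X then 1 else -1)"], goal_cases)
    case (5 X)
    then have X: "X \<subseteq> {..<k}" by simp
    have "(\<Prod>l<k. h l (vec k (\<lambda>l. if l \<in> X then 1 else -1) $ l)) =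
        (\<Prod>l\<in>{..<k} - X. h l (vec k (\<lambda>l. if l \<in> X then 1 else -1) $ l)) *
        (\<Prod>l\<in>X. h l (vec k (\<lambda>l. if l \<in> X then 1 else -1) $ l))"
      by (rule prod.subset_diff[OF X]) simp
    also have "\<dots> = (\<Prod>l\<in>{..<k} - X. h l (-1)) * (\<Prod>l\<in>X. h l 1)"
      using X by (intro arg_cong2[of _ _ _ _ "(*)"] prod.cong) auto
    finally show ?case by (simp add: mult.commute)
  next
    case (3 s)
    then show ?case by (intro eq_vecI) (auto simp: sign_vecs_def)
  qed (auto simp: sign_vecs_def split: if_splits)
  finally show ?thesis ..
qed

lemma weighted_outer_sum_entry:
  assumes ij: "i < k" "j < k"
    and pos: "\<And>l. l < k \<Longrightarrow> plus_factor m (x l) \<noteq> 0"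
  shows "(\<Sum>s\<in>sign_vecs k. (\<Prod>l<k. approx_exp m (s $ l * x l)) * (s $ i * s $ j)) =
    entry k (\<Prod>l<k. plus_factor m (x l)) (\<lambda>l. ratio_factor m (x l)) (i * k + j)"
proof (cases "i = j")
  case True
  have "(\<Sum>s\<in>sign_vecs k. (\<Prod>l<k. approx_exp m (s $ l * x l)) * (s $ i * s $ j)) =
      (\<Sum>s\<in>sign_vecs k. \<Prod>l<k. approx_exp m (s $ l * x l))"
    using ij True by (intro sum.cong refl) (auto simp: sign_vecs_def)
  also have "\<dots> = (\<Prod>l<k. plus_factor m (x l))"
    using sum_sign_vecs_prod[of "\<lambda>l v. approx_exp m (v * x l)" k] by (simp add: plus_factor_def)
  finally show ?thesis using True ij by (simp add: entry_def)
next
  case False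
  \<comment> \<open>The factors \<open>s $ i\<close> and \<open>s $ j\<close> are absorbed into the
    factors of the product at \<open>l = i\<close> and \<open>l = j\<close>, which restores product
    form.\<close>
  let ?h = "\<lambda>l v. approx_exp m (v * x l) * ((if l = i then v else 1) * (if l = j then v else 1))"
  let ?r = "\<lambda>l. ratio_factor m (x l)"
  have "(\<Sum>s\<in>sign_vecs k. (\<Prod>l<k. approx_exp m (s $ l * x l)) * (s $ i * s $ j)) =
      (\<Sum>s\<in>sign_vecs k. \<Prod>l<k. ?h l (s $ l))"
    using ij by (simp add: prod.distrib prod.delta)
  also have "\<dots> = (\<Prod>l<k. ?h l 1 + ?h l (-1))"
    by (rule sum_sign_vecs_prod)
  \<comment> \<open>At \<open>l = i\<close> or \<open>l = j\<close> the sum has become a difference,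
    which is \<open>plus_factor\<close> times \<open>ratio_factor\<close> as the former is nonzero.
    Since \<open>i\<close> and \<open>j\<close> differ, no factor is hit twice.\<close>
  also have "\<dots> = (\<Prod>l<k. plus_factor m (x l) * ((if l = i then ?r l else 1) * (if l = j then ?r l else 1)))"
    using pos False by (intro prod.cong refl) (auto simp: plus_factor_def ratio_factor_def)
  also have "\<dots> = (\<Prod>l<k. plus_factor m (x l)) * (?r i * ?r j)"
    using ij by (simp add: prod.distrib prod.delta)
  finally show ?thesis using False ij by (simp add: entry_def)
qed

section \<open>The running time\<close>

lemma ln_2_ge_half: "ln 2 \<ge> (1 / 2 :: real)"
  using ln_le_minus_one[of "1 / 2 :: real"] by (simp add: ln_div)

text \<open>Minimality puts \<open>2 ^ (m - 1)\<close> below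
  \<open>M_bound \<epsilon> \<rho>\<close> when \<open>m = log_steps \<epsilon> \<rho>\<close> is
  positive, so \<open>2 ^ m \<le> 2 * M_bound \<epsilon> \<rho> \<le> L ^ 5\<close>. Logarithms and
  \<open>ln 2 \<ge> 1 / 2\<close> turn the 5 into 10.\<close>

lemma log_steps_bound:
  assumes \<epsilon>: "\<epsilon> > 0" and \<rho>: "\<rho> > 0" and L: "3 \<le> L" "\<rho> \<le> L" "1 / \<epsilon> \<le> L - 1"
  shows "M_bound \<epsilon> \<rho> \<le> 2 ^ log_steps \<epsilon> \<rho>" "real (log_steps \<epsilon> \<rho>) \<le> 10 * ln L"
proof -
  have "\<exists>m. M_bound \<epsilon> \<rho> < 2 ^ m" by (rule real_arch_pow) simp
  then show "M_bound \<epsilon> \<rho> \<le> 2 ^ log_steps \<epsilon> \<rho>"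
    unfolding log_steps_def by (metis (mono_tags, lifting) LeastI_ex less_imp_le)
  have M: "2 * M_bound \<epsilon> \<rho> \<le> L ^ 5"
  proof -
    have "\<rho> * \<rho> * (1 + 1 / \<epsilon>) \<le> L * L * L"
      using assms by (intro mult_mono) auto
    then have "2 * M_bound \<epsilon> \<rho> \<le> 4 * L + 4 * (L * L * L)" using L(2) by (simp add: M_bound_def)
    also have "\<dots> \<le> (3 * 3) * (L * L * L)"
    proof -
      have "1 * 1 * L \<le> L * L * L" using L(1) by (intro mult_mono) auto
      then show ?thesis using L(1) by simp
    qed
    also have "\<dots> \<le> (L * L) * (L * L * L)" using L(1) by (intro mult_right_mono mult_mono) auto
    finally show ?thesis by (simp add: eval_nat_numeral algebra_simps)
  qed
  have "2 ^ log_steps \<epsilon> \<rho> \<le> L ^ 5"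
  proof (cases "log_steps \<epsilon> \<rho>")
    case 0
    then show ?thesis using L(1) by (simp add: one_le_power)
  next
    case (Suc n)
    then have "\<not> M_bound \<epsilon> \<rho> \<le> 2 ^ n"
      unfolding log_steps_def by (metis lessI not_less_Least)
    then show ?thesis using M Suc by simp
  qed
  then have "ln (2 ^ log_steps \<epsilon> \<rho>) \<le> ln (L ^ 5)" using L(1) by (subst ln_le_cancel_iff) auto
  then have "real (log_steps \<epsilon> \<rho>) * ln 2 \<le> 5 * ln L" using L(1) by (simp add: ln_realpow)
  moreover have "real (log_steps \<epsilon> \<rho>) * (1 / 2) \<le> real (log_steps \<epsilon> \<rho>) * ln 2"
    using ln_2_ge_half by (intro mult_left_mono) auto
  ultimately show "real (log_steps \<epsilon> \<rho>) \<le> 10 * ln L" by linarith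
qed

text \<open>The program is assembled from its end: each intermediate fact treats a suffix, for any
  store that meets what the suffix reads. Each 5 is a generous price for one assignment.\<close>

lemma prog_runs:
  fixes f :: "real vec"
  assumes m: "m = log_steps \<epsilon> \<rho>" "M_bound \<epsilon> \<rho> \<le> 2 ^ m"
  shows "runs prog (input_store k \<epsilon> u \<rho> f)
    (60 + (20 * m + 10) + (k * (50 * m + 116) + 10) + (k * (60 * k + 36) + 10))
    (\<lambda>\<tau>. \<forall>q < k * k. reals \<tau> ''P'' q =
      entry k (\<Prod>l<k. plus_factor m (f $ l / u)) (\<lambda>l. ratio_factor m (f $ l / u)) q)"
    (is "runs _ _ _ ?Q")
proof -
  let ?\<sigma> = "input_store k \<epsilon> u \<rho> f"
  let ?g = "reals ?\<sigma> ''f''"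
  \<comment> \<open>The array holds 0 from index \<open>k\<close> on, where \<open>f $ l\<close> has
    no specified value, so the two are compared only below \<open>k\<close>.\<close>
  have g: "?g l = f $ l" if "l < k" for l using that by (simp add: input_store_def)
  have rows: "runs (Seq (ISet ''i'' (IConst 0)) rows) \<tau> (5 + (k * (60 * k + 36) + 10)) ?Q"
    if "ints \<tau> ''k'' 0 = k" "ints \<tau> ''p'' 0 = 0"
      "reals \<tau> ''Q'' 0 = (\<Prod>l<k. plus_factor m (f $ l / u))"
      "\<And>l. l < k \<Longrightarrow> reals \<tau> ''T'' l = ratio_factor m (f $ l / u)" for \<tau>
    by (intro conjI runs_assign(3,4)[THEN iffD2] runs_mono[OF rows_runs]) (use that in simp_all)
  have factors: "runs (Seq (RSet ''Q'' (RConst 1)) (Seq factors (Seq (ISet ''i'' (IConst 0)) rows)))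
      \<tau> (5 + ((k * (50 * m + 116) + 10) + (5 + (k * (60 * k + 36) + 10)))) ?Q"
    if "ints \<tau> ''k'' 0 = k" "ints \<tau> ''m'' 0 = m" "ints \<tau> ''i'' 0 = 0" "ints \<tau> ''p'' 0 = 0"
      "reals \<tau> ''u'' 0 = u" "reals \<tau> ''N'' 0 = 2 ^ m" "reals \<tau> ''f'' = ?g" for \<tau>
  proof -
    have "runs (Seq factors (Seq (ISet ''i'' (IConst 0)) rows)) (rupd ''Q'' 0 1 \<tau>)
        ((k * (50 * m + 116) + 10) + (5 + (k * (60 * k + 36) + 10))) ?Q"
      by (rule runs_Seq, rule runs_mono[OF factors_runs[where f = ?g and u = u] order_refl rows])
         (use that in \<open>simp_all add: g\<close>)
    then show ?thesis by (auto elim: runs_mono)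
  qed
  have "runs (Seq doubling (Seq (RSet ''Q'' (RConst 1)) (Seq factors (Seq (ISet ''i'' (IConst 0)) rows))))
      (rupd ''M'' 0 (M_bound \<epsilon> \<rho>) (rupd ''N'' 0 1 ?\<sigma>))
      ((20 * m + 10) + (5 + ((k * (50 * m + 116) + 10) + (5 + (k * (60 * k + 36) + 10))))) ?Q"
    by (rule runs_Seq, rule runs_mono[OF doubling_runs[OF refl m(1,2)] order_refl factors])
       (simp_all add: input_store_def)
  then show ?thesis
    unfolding prog_def by (auto elim!: runs_mono simp: input_store_def M_bound_def)
qed

theorem theorem7p3:
  "\<exists>(prog :: com) (C :: real) (d :: nat).
     \<forall>(k :: nat) (\<epsilon> :: real) (u :: real) (\<rho> :: real) (f :: real vec).
       k \<ge> 1 \<longrightarrow> \<epsilon> > 0 \<longrightarrow> u > 0 \<longrightarrow> \<rho> > 0 \<longrightarrow>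
       f \<in> carrier_vec k \<longrightarrow> l1_norm f \<le> \<rho> * u \<longrightarrow>
       (\<exists>t \<sigma>. exec prog (input_store k \<epsilon> u \<rho> f) t \<sigma> \<and>
          (\<exists>w. (\<forall>s\<in>sign_vecs k.
                  exp ((s \<bullet> f) / u) \<le> w s \<and> w s \<le> (1 + \<epsilon>) * exp ((s \<bullet> f) / u)) \<and>
               output_mat k \<sigma> = weighted_outer_sum k w) \<and>
          soft_O_bound C d k \<epsilon> \<rho> t)"
proof (rule exI[of _ prog], rule exI[of _ 4000], rule exI[of _ 1], intro allI impI)
  fix k :: nat and \<epsilon> u \<rho> :: real and f :: "real vec"
  assume k: "k \<ge> 1" and \<epsilon>: "\<epsilon> > 0" and u: "u > 0" and \<rho>: "\<rho> > 0"
    and f: "f \<in> carrier_vec k" "l1_norm f \<le> \<rho> * u"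
  define L where "L = 2 + real k + \<rho> + 1 / \<epsilon>"
  define m where "m = log_steps \<epsilon> \<rho>"
  define x where "x = (\<lambda>l. f $ l / u)"
  have L: "3 \<le> L" "\<rho> \<le> L" "1 / \<epsilon> \<le> L - 1"
    using k \<rho> zero_less_divide_1_iff[of \<epsilon>] \<epsilon> unfolding L_def by linarith+
  have m: "M_bound \<epsilon> \<rho> \<le> 2 ^ m" "real m \<le> 10 * ln L"
    using log_steps_bound[OF \<epsilon> \<rho> L] by (auto simp: m_def)
  have x: "(\<Sum>l<k. \<bar>x l\<bar>) \<le> \<rho>"
    using f u by (auto simp: l1_norm_def x_def field_simps simp flip: sum_divide_distrib)
  have xl: "2 * \<bar>x l\<bar> \<le> 2 ^ m" if "l < k" for l
  proof -
    have "\<bar>x l\<bar> \<le> \<rho>" using member_le_sum[of l "{..<k}" "\<lambda>l. \<bar>x l\<bar>"] that x by auto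
    moreover have "2 * \<rho> \<le> M_bound \<epsilon> \<rho>" using \<epsilon> \<rho> by (simp add: M_bound_def)
    ultimately show ?thesis using m(1) by linarith
  qed
  \<comment> \<open>Both summands dominate a positive exponential, because the size condition on
    \<open>x l\<close> is symmetric in sign.\<close>
  have pos: "plus_factor m (x l) \<noteq> 0" if "l < k" for l
    using approx_exp_bounds(1)[of "x l" m] approx_exp_bounds(1)[of "- x l" m] xl[OF that]
      exp_gt_zero[of "x l"] exp_gt_zero[of "- x l"]
    unfolding plus_factor_def by force
  define w where "w = (\<lambda>s. \<Prod>l<k. approx_exp m (s $ l * x l))"
  from prog_runs[OF m_def m(1), of k u f] obtain t \<tau> where run: "exec prog (input_store k \<epsilon> u \<rho> f) t \<tau>"
    and t: "t \<le> 60 + (20 * m + 10) + (k * (50 * m + 116) + 10) + (k * (60 * k + 36) + 10)"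
    and P: "\<And>q. q < k * k \<Longrightarrow> reals \<tau> ''P'' q =
      entry k (\<Prod>l<k. plus_factor m (x l)) (\<lambda>l. ratio_factor m (x l)) q"
    unfolding runs_def x_def by blast
  have out: "output_mat k \<tau> = weighted_outer_sum k w"
  proof (rule eq_matI)
    fix i j assume "i < dim_row (weighted_outer_sum k w)" "j < dim_col (weighted_outer_sum k w)"
    then have ij: "i < k" "j < k" by (auto simp: weighted_outer_sum_def)
    \<comment> \<open>This is \<open>i * k + j < Suc i * k \<le> k * k\<close>.\<close>
    then have "i * k + j < k * k"
      by (metis add_less_cancel_left less_le_trans mult_le_mono1 mult_Suc add.commute Suc_leI)
    with ij show "output_mat k \<tau> $$ (i, j) = weighted_outer_sum k w $$ (i, j)"
      using weighted_outer_sum_entry[OF ij, of m x] pos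
      by (simp add: output_mat_def weighted_outer_sum_def P w_def)
  qed (auto simp: output_mat_def weighted_outer_sum_def)
  have weights: "exp ((s \<bullet> f) / u) \<le> w s \<and> w s \<le> (1 + \<epsilon>) * exp ((s \<bullet> f) / u)"
    if s: "s \<in> sign_vecs k" for s
  proof -
    have "(\<Sum>l<k. \<bar>s $ l * x l\<bar>) = (\<Sum>l<k. \<bar>x l\<bar>)"
      using s by (intro sum.cong refl) (auto simp: sign_vecs_def abs_mult)
    then have "(\<Sum>l<k. \<bar>s $ l * x l\<bar>) \<le> \<rho>" using x by simp
    moreover have "(s \<bullet> f) / u = (\<Sum>l<k. s $ l * x l)"
      using f(1) by (simp add: scalar_prod_def x_def sum_divide_distrib atLeast0LessThan)
    ultimately show ?thesis using prod_approx_exp_bounds[OF \<epsilon> _ m(1)] by (simp add: w_def)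
  qed
  have "soft_O_bound 4000 1 k \<epsilon> \<rho> t"
  proof -
    \<comment> \<open>As \<open>exp 1 \<le> 3 \<le> L\<close>, additive constants can be absorbed
      into \<open>ln L\<close>.\<close>
    have "ln (exp 1) \<le> ln L" using L(1) exp_le by (subst ln_le_cancel_iff) auto
    then have ln1: "1 \<le> ln L" by simp
    have k2: "1 \<le> real k ^ 2" "real k \<le> real k ^ 2" using k by (auto intro: one_le_power self_le_power)
    have "real t \<le> real (60 + (20 * m + 10) + (k * (50 * m + 116) + 10) + (k * (60 * k + 36) + 10))"
      using t of_nat_mono by blast
    also have "\<dots> = 90 * 1 + 152 * real k + 60 * real k ^ 2 + 20 * (1 * real m) + 50 * (real k * real m)"
      by (simp add: algebra_simps power2_eq_square)
    also have "\<dots> \<le> 90 * real k ^ 2 + 152 * real k ^ 2 + 60 * real k ^ 2 +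
        20 * (real k ^ 2 * real m) + 50 * (real k ^ 2 * real m)"
      using k2 by (intro add_mono mult_left_mono mult_right_mono) auto
    also have "\<dots> = real k ^ 2 * (302 + 70 * real m)" by (simp add: algebra_simps)
    \<comment> \<open>The bounds \<open>302 \<le> 302 * ln L\<close> and
      \<open>70 * m \<le> 700 * ln L\<close> fit well within 4000. Only \<open>m\<close> brings in a
      logarithm, hence degree 1.\<close>
    also have "\<dots> \<le> real k ^ 2 * (4000 * ln L)"
      using m(2) ln1 by (intro mult_left_mono) auto
    also have "\<dots> \<le> max (real k ^ 4 * \<rho> / \<epsilon>) (real k ^ 2) * (4000 * ln L)"
      using ln1 by (intro mult_right_mono) auto
    finally show ?thesis unfolding soft_O_bound_def L_def by (simp add: algebra_simps)
  qed
  with run out weights show "\<exists>t \<sigma>. exec prog (input_store k \<epsilon> u \<rho> f) t \<sigma> \<and>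
          (\<exists>w. (\<forall>s\<in>sign_vecs k.
                  exp ((s \<bullet> f) / u) \<le> w s \<and> w s \<le> (1 + \<epsilon>) * exp ((s \<bullet> f) / u)) \<and>
               output_mat k \<sigma> = weighted_outer_sum k w) \<and>
          soft_O_bound 4000 1 k \<epsilon> \<rho> t"
    by blast
qed

end
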